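(* Let $(R,\mathfrak{m},F)$ be a commutative local ring with residue field $F=R/\mathfrak{m}\neq \mathbb{F}_2$. Let $V$ be an inner product space over $R$. Then any two orthogonal bases of $V$ are chain equivalent.
   Context: An inner product space over a commutative ring $R$ is a finitely generated projective $R$-module $V$ equipped with a non-degenerate symmetric $R$-bilinear form $\mathfrak{b}:V\times V\to R$ (non-degenerate: the adjoint map $V\to \operatorname{Hom}_R(V,R)$ is an isomorphism). When $R$ is local, $V$ is free of some finite rank $n$; an orthogonal basis of $V$ is a basis $v_1,\dots,v_n$ of $V$ with $\mathfrak{b}(v_i,v_j)=0$ for $i\neq j$ (such a basis need not exist). Two orthogonal bases $B,C$ of $V$ are chain equivalent, written $B\approx C$ (or $B\approx_R C$), if there is a sequence $B_0,B_1,\dots,B_r$ of orthogonal bases of $V$ such that $B_0=B$, $B_r=C$, and $B_{i-1}\cap B_i$ has cardinality at least $n-2$ for $i=1,\dots,r$. *)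

theory Defs
  imports
    "HOL-Algebra.Algebraic_Closure_Type"
    "HOL-Number_Theory.Residues"
    "HOL-Library.Poly_Mapping"
begin

text \<open>
  Rings are types of class \<open>comm_ring_1\<close> and modules are given by the locale \<open>module\<close> of
  theory \<open>Modules\<close> (written \<open>Modules.module\<close>, since HOL-Algebra has a locale of the same name).
  Ideals and quotients are taken in the HOL-Algebra record \<open>ring_of_type_algebra\<close>, whose carrier
  is the whole type.
\<close>

definition local_ring :: "'a::comm_ring_1 set \<Rightarrow> bool" where
  "local_ring \<mm> \<longleftrightarrow>
     maximalideal \<mm> ring_of_type_algebra \<and>
     (\<forall>J :: 'a set. maximalideal J ring_of_type_algebra \<longrightarrow> J = \<mm>)"

definition residue_field :: "'a::comm_ring_1 set \<Rightarrow> 'a set ring" where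
  "residue_field \<mm> = ring_of_type_algebra Quot \<mm>"

text \<open>
  The free module on a type \<open>'i\<close> consists of the finitely supported functions
  \<open>'i \<Rightarrow>\<^sub>0 'a\<close>, with pointwise scalar multiplication.
\<close>

definition free_scale :: "'a::comm_ring_1 \<Rightarrow> ('i \<Rightarrow>\<^sub>0 'a) \<Rightarrow> ('i \<Rightarrow>\<^sub>0 'a)" where
  "free_scale r f = Poly_Mapping.map ((*) r) f"

lemma lookup_free_scale [simp]:
  "poly_mapping.lookup (free_scale r f) i = r * poly_mapping.lookup f i"
  by (simp add: free_scale_def Poly_Mapping.map.rep_eq when_def)

lemma module_free_scale: "Modules.module free_scale"
  by unfold_locales (auto intro!: poly_mapping_eqI simp: lookup_add algebra_simps)

definition finitely_generated_module ::
  "('a::comm_ring_1 \<Rightarrow> 'b::ab_group_add \<Rightarrow> 'b) \<Rightarrow> bool" where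
  "finitely_generated_module scale \<longleftrightarrow>
     Modules.module scale \<and> (\<exists>S. finite S \<and> module.span scale S = UNIV)"

text \<open>
  A module is projective if it is a direct summand (i.e. a retract) of a free module.  Every
  module \<open>V\<close> is a quotient of the free module on its own underlying set, and \<open>V\<close> is a summand
  of some free module iff it is a summand of that one, so it is enough to allow
  \<open>'b\<close> as the index type.
\<close>

definition projective_module ::
  "('a::comm_ring_1 \<Rightarrow> 'b::ab_group_add \<Rightarrow> 'b) \<Rightarrow> bool" where
  "projective_module scale \<longleftrightarrow>
     (\<exists>(s :: 'b \<Rightarrow> ('b \<Rightarrow>\<^sub>0 'a)) (p :: ('b \<Rightarrow>\<^sub>0 'a) \<Rightarrow> 'b).
        Modules.module_hom scale free_scale s \<and>
        Modules.module_hom free_scale scale p \<and>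
        p \<circ> s = id)"

locale inner_product_space = Modules.module scale
  for scale :: "'a::comm_ring_1 \<Rightarrow> 'b::ab_group_add \<Rightarrow> 'b" +
  fixes \<bb> :: "'b \<Rightarrow> 'b \<Rightarrow> 'a"
  assumes finitely_generated: "finitely_generated_module scale"
    and projective: "projective_module scale"
    and linear_left: "\<And>y. Modules.module_hom scale (*) (\<lambda>x. \<bb> x y)"
    and linear_right: "\<And>x. Modules.module_hom scale (*) (\<lambda>y. \<bb> x y)"
    and symmetric: "\<And>x y. \<bb> x y = \<bb> y x"
    and nondegenerate: "bij_betw (\<lambda>x y. \<bb> x y) UNIV {f. Modules.module_hom scale (*) f}"
begin

definition is_basis :: "'b set \<Rightarrow> bool" where
  "is_basis B \<longleftrightarrow> finite B \<and> independent B \<and> span B = UNIV"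

text \<open>
  All bases have the same cardinality because \<open>'a\<close> is a nonzero commutative ring.
\<close>

definition rank :: nat where
  "rank = (THE n. \<exists>B. is_basis B \<and> card B = n)"

definition orthogonal_basis :: "'b set \<Rightarrow> bool" where
  "orthogonal_basis B \<longleftrightarrow> is_basis B \<and> (\<forall>v\<in>B. \<forall>w\<in>B. v \<noteq> w \<longrightarrow> \<bb> v w = 0)"

text \<open>
  The condition \<open>card (Bs (i - 1) \<inter> Bs i) \<ge> rank - 2\<close> is written additively.
\<close>

definition chain_equivalent :: "'b set \<Rightarrow> 'b set \<Rightarrow> bool" where
  "chain_equivalent B C \<longleftrightarrow>
     (\<exists>(r :: nat) (Bs :: nat \<Rightarrow> 'b set).
        (\<forall>i\<le>r. orthogonal_basis (Bs i)) \<and> Bs 0 = B \<and> Bs r = C \<and>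
        (\<forall>i\<in>{1..r}. rank \<le> card (Bs (i - 1) \<inter> Bs i) + 2))"

end

end

theory Submission
  imports Defs
begin

text \<open>
  Fix \<open>w\<close> in the target basis \<open>C\<close> and an orthogonal basis \<open>B\<close>. The weights
  \<open>x\<^sub>v = \<bb> w v ^ 2 / \<bb> v v\<close> for \<open>v \<in> B\<close> sum to the unit \<open>\<bb> w w\<close>. If two of them have a unit as
  their sum, rotating the plane of these two vectors replaces them by one vector carrying the summed
  weight and one vector orthogonal to \<open>w\<close>; repeating this leaves a single vector, which can then be
  exchanged for \<open>w\<close>. The process gets stuck only if 2 is not a unit and all nonzero weights are
  congruent units. If some \<open>z \<in> B\<close> outside the part already agreeing with \<open>C\<close> is orthogonal to \<open>w\<close>,
  mixing \<open>z\<close> into a vector of the support perturbs its weight, which needs a residue class other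
  than 0 and 1. If there is no such \<open>z\<close>, then \<open>w\<close> is characteristic modulo \<open>\<mm>\<close>: \<open>\<bb> u w = 0\<close>
  forces \<open>\<bb> u u \<in> \<mm>\<close>, contradicting the existence of further vectors \<open>u\<close> in \<open>C\<close>.
\<close>

section \<open>Ideals, units and residue field of a local ring\<close>

lemma ideal_ring_of_type_iff:
  fixes J :: "'a::comm_ring_1 set"
  shows "ideal J ring_of_type_algebra \<longleftrightarrow>
    0 \<in> J \<and> (\<forall>x\<in>J. \<forall>y\<in>J. x + y \<in> J) \<and> (\<forall>r. \<forall>x\<in>J. r * x \<in> J)"
    (is "?L \<longleftrightarrow> ?R")
proof
  assume ?L
  then interpret ideal J ring_of_type_algebra .
  have "0 \<in> J" "x \<in> J \<Longrightarrow> y \<in> J \<Longrightarrow> x + y \<in> J" "x \<in> J \<Longrightarrow> r * x \<in> J" for r x y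
    using additive_subgroup.zero_closed[OF is_additive_subgroup]
      additive_subgroup.a_closed[OF is_additive_subgroup, of x y] I_l_closed[of x r]
    by (simp_all add: ring_of_type_algebra_def)
  then show ?R by blast
next
  assume R: ?R
  have neg: "- x \<in> J" if "x \<in> J" for x
    using R that by (metis mult_minus1)
  have inv: "inv\<^bsub>add_monoid (ring_of_type_algebra :: 'a ring)\<^esub> x = - x" for x :: 'a
  proof -
    interpret abelian_group "ring_of_type_algebra :: 'a ring"
      using ring_from_type_algebra ring.is_abelian_group by blast
    show ?thesis
      using minus_equality[of "- x" x] by (simp add: ring_of_type_algebra_def a_inv_def)
  qed
  show ?L
  proof (rule idealI)
    show "ring (ring_of_type_algebra :: 'a ring)" by (rule ring_from_type_algebra)
    show "subgroup J (add_monoid ring_of_type_algebra)"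
    proof (rule subgroup.intro)
      fix x assume "x \<in> J"
      then show "inv\<^bsub>add_monoid ring_of_type_algebra\<^esub> x \<in> J" unfolding inv by (rule neg)
    qed (use R in \<open>simp_all add: ring_of_type_algebra_def\<close>)
    fix a x :: 'a
    assume "a \<in> J"
    then have "x * a \<in> J" using R by blast
    then show "x \<otimes>\<^bsub>ring_of_type_algebra\<^esub> a \<in> J" "a \<otimes>\<^bsub>ring_of_type_algebra\<^esub> x \<in> J"
      by (simp_all add: ring_of_type_algebra_def mult.commute)
  qed
qed

text \<open>Krull's theorem by Zorn's lemma. Properness of an ideal is expressed as
  \<open>1 \<notin> J\<close>, a condition that visibly passes to unions of chains.\<close>

lemma ideal_avoiding_one_subset_maximalideal:
  fixes I :: "'a::comm_ring_1 set"
  assumes "ideal I ring_of_type_algebra" "1 \<notin> I"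
  obtains M where "maximalideal M ring_of_type_algebra" "I \<subseteq> M"
proof -
  define A where "A = {J::'a set. ideal J ring_of_type_algebra \<and> I \<subseteq> J \<and> 1 \<notin> J}"
  have "\<exists>M\<in>A. \<forall>J\<in>A. M \<subseteq> J \<longrightarrow> J = M"
  proof (rule subset_Zorn_nonempty)
    show "A \<noteq> {}" using assms by (auto simp: A_def)
  next
    fix \<C> assume C: "\<C> \<noteq> {}" "subset.chain A \<C>"
    then have sub: "\<C> \<subseteq> A" and lin: "\<And>J K. J \<in> \<C> \<Longrightarrow> K \<in> \<C> \<Longrightarrow> J \<subseteq> K \<or> K \<subseteq> J"
      unfolding subset_chain_def by blast+
    have *: "0 \<in> J" "x \<in> J \<Longrightarrow> y \<in> J \<Longrightarrow> x + y \<in> J" "x \<in> J \<Longrightarrow> r * x \<in> J"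
      "I \<subseteq> J" "1 \<notin> J" if "J \<in> \<C>" for J r x y
    proof -
      from sub that have "J \<in> A" by blast
      then show "0 \<in> J" "x \<in> J \<Longrightarrow> y \<in> J \<Longrightarrow> x + y \<in> J" "x \<in> J \<Longrightarrow> r * x \<in> J"
        "I \<subseteq> J" "1 \<notin> J"
        by (simp_all add: A_def ideal_ring_of_type_iff)
    qed
    show "\<Union>\<C> \<in> A"
      unfolding A_def mem_Collect_eq ideal_ring_of_type_iff
    proof (intro conjI ballI allI)
      fix x y assume "x \<in> \<Union>\<C>" "y \<in> \<Union>\<C>"
      then obtain J K where JK: "J \<in> \<C>" "x \<in> J" "K \<in> \<C>" "y \<in> K" by blast
      then have "x + y \<in> J \<or> x + y \<in> K"
        using lin[of J K] *(2)[of J x y] *(2)[of K x y] by (meson subsetD)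
      then show "x + y \<in> \<Union>\<C>" using JK by blast
    next
      fix r x assume "x \<in> \<Union>\<C>"
      then show "r * x \<in> \<Union>\<C>" using *(3) by (meson UnionE UnionI)
    next
      obtain J where "J \<in> \<C>" using C(1) by blast
      then show "0 \<in> \<Union>\<C>" "I \<subseteq> \<Union>\<C>" using *(1,4)[of J] by (meson UnionI, meson Union_upper subset_trans)
    next
      show "1 \<notin> \<Union>\<C>" using *(5) by (meson UnionE)
    qed
  qed
  then obtain M where M: "M \<in> A" "\<And>J. J \<in> A \<Longrightarrow> M \<subseteq> J \<Longrightarrow> J = M" by blast
  have "maximalideal M ring_of_type_algebra"
  proof (rule maximalidealI)
    show "ideal M ring_of_type_algebra" using M(1) by (simp add: A_def)
    show "carrier ring_of_type_algebra \<noteq> M"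
      using M(1) by (auto simp: A_def ring_of_type_algebra_def)
    fix J :: "'a set"
    assume J: "ideal J ring_of_type_algebra" "M \<subseteq> J"
    show "J = M \<or> J = carrier ring_of_type_algebra"
    proof (cases "1 \<in> J")
      case True
      then have "r \<in> J" for r
      proof -
        have "r * 1 \<in> J" using J(1) True unfolding ideal_ring_of_type_iff by blast
        then show ?thesis by simp
      qed
      then show ?thesis by (auto simp: ring_of_type_algebra_def)
    next
      case False
      then have "J \<in> A" using M(1) J by (simp add: A_def) blast
      then show ?thesis using M(2) J(2) by blast
    qed
  qed
  then show ?thesis using that M(1) unfolding A_def by blast
qed

lemma
  assumes "local_ring \<mm>"
  shows local_ring_zero: "0 \<in> \<mm>"
    and local_ring_add: "x \<in> \<mm> \<Longrightarrow> y \<in> \<mm> \<Longrightarrow> x + y \<in> \<mm>"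
    and local_ring_mult: "x \<in> \<mm> \<Longrightarrow> r * x \<in> \<mm>"
    and local_ring_mult_right: "x \<in> \<mm> \<Longrightarrow> x * r \<in> \<mm>"
    and local_ring_uminus: "x \<in> \<mm> \<Longrightarrow> - x \<in> \<mm>"
    and local_ring_diff: "x \<in> \<mm> \<Longrightarrow> y \<in> \<mm> \<Longrightarrow> x - y \<in> \<mm>"
    and local_ring_sum: "(\<And>i. i \<in> I \<Longrightarrow> f i \<in> \<mm>) \<Longrightarrow> sum f I \<in> \<mm>"
proof -
  have "ideal \<mm> ring_of_type_algebra"
    using assms by (simp add: local_ring_def maximalideal_def)
  then have R: "0 \<in> \<mm>" "\<And>x y. x \<in> \<mm> \<Longrightarrow> y \<in> \<mm> \<Longrightarrow> x + y \<in> \<mm>"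
    "\<And>r x. x \<in> \<mm> \<Longrightarrow> r * x \<in> \<mm>"
    by (auto simp: ideal_ring_of_type_iff)
  show "0 \<in> \<mm>" "x \<in> \<mm> \<Longrightarrow> y \<in> \<mm> \<Longrightarrow> x + y \<in> \<mm>" "x \<in> \<mm> \<Longrightarrow> r * x \<in> \<mm>"
    "x \<in> \<mm> \<Longrightarrow> x * r \<in> \<mm>"
    using R R(3)[of x r] by (simp_all add: mult.commute)
  show neg: "- x \<in> \<mm>" if "x \<in> \<mm>" for x using R(3)[OF that, of "-1"] by simp
  show "x \<in> \<mm> \<Longrightarrow> y \<in> \<mm> \<Longrightarrow> x - y \<in> \<mm>" using R(2)[of x "- y"] neg by simp
  show "(\<And>i. i \<in> I \<Longrightarrow> f i \<in> \<mm>) \<Longrightarrow> sum f I \<in> \<mm>"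
    by (induction I rule: infinite_finite_induct) (auto intro: R)
qed

text \<open>The multiples of a nonunit form a proper ideal, which lies in some maximal ideal and
  hence in \<open>\<mm>\<close>. From here on \<open>a dvd 1\<close> and
  \<open>a \<notin> \<mm>\<close> are interchangeable.\<close>

lemma local_ring_unit_iff:
  fixes \<mm> :: "'a::comm_ring_1 set"
  assumes "local_ring \<mm>"
  shows "a dvd 1 \<longleftrightarrow> a \<notin> \<mm>"
proof
  have "\<mm> \<noteq> UNIV"
    using assms maximalideal.I_notcarr[of \<mm> ring_of_type_algebra]
    by (auto simp: local_ring_def ring_of_type_algebra_def)
  then have "1 \<notin> \<mm>"
    using local_ring_mult_right[OF assms, of 1] by auto
  moreover have "1 \<in> \<mm>" if "a dvd 1" "a \<in> \<mm>"
  proof -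
    from \<open>a dvd 1\<close> obtain k where k: "1 = a * k" by (rule dvdE)
    show ?thesis by (subst k) (intro local_ring_mult_right[OF assms] \<open>a \<in> \<mm>\<close>)
  qed
  ultimately show "a dvd 1 \<Longrightarrow> a \<notin> \<mm>" by blast
next
  assume a: "a \<notin> \<mm>"
  show "a dvd 1"
  proof (rule ccontr)
    assume na: "\<not> a dvd 1"
    have "ideal {x. a dvd x} ring_of_type_algebra"
      by (auto simp: ideal_ring_of_type_iff)
    moreover have "1 \<notin> {x. a dvd x}" using na by simp
    ultimately obtain M where M: "maximalideal M ring_of_type_algebra" "{x. a dvd x} \<subseteq> M"
      by (rule ideal_avoiding_one_subset_maximalideal)
    have "a \<in> M" using M(2) by auto
    moreover have "M = \<mm>" using assms M(1) by (simp add: local_ring_def)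
    ultimately show False using a by simp
  qed
qed

text \<open>If 0 and 1 were the only residue classes, the indicator function of the complement of
  \<open>\<mm>\<close> would be a surjective ring homomorphism onto the integers modulo 2 with
  kernel \<open>\<mm>\<close>, and the residue field would have two elements.\<close>

lemma local_ring_not_F2:
  fixes \<mm> :: "'a::comm_ring_1 set"
  assumes loc: "local_ring \<mm>" and F: "\<not> (residue_field \<mm> \<simeq> residue_ring 2)"
  obtains t where "t \<notin> \<mm>" "t - 1 \<notin> \<mm>"
proof (rule ccontr)
  assume "\<not> thesis"
  with that have two: "t \<in> \<mm> \<or> t - 1 \<in> \<mm>" for t by blast
  note m = local_ring_zero[OF loc] local_ring_add[OF loc] local_ring_mult[OF loc]
    local_ring_mult_right[OF loc] local_ring_uminus[OF loc] local_ring_diff[OF loc]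
  have one: "1 \<notin> \<mm>" using local_ring_unit_iff[OF loc, of 1] by simp
  define h :: "'a \<Rightarrow> int" where "h = (\<lambda>a. if a \<in> \<mm> then 0 else 1)"
  have add_in: "a + b \<in> \<mm>" if "a \<notin> \<mm>" "b \<notin> \<mm>" for a b
  proof -
    \<comment> \<open>The case \<open>t = -1\<close> of \<open>two\<close>: as -1 is a unit, -2 must
      lie in \<open>\<mm>\<close>.\<close>
    have "(2::'a) \<in> \<mm>" using two[of "-1"] one m(5)[of "-1"] m(5)[of "-2"] by auto
    then have "(a - 1) + (b - 1) + 2 \<in> \<mm>" using m(2) two that by blast
    then show ?thesis by (simp add: algebra_simps)
  qed
  have mult_notin: "a * b \<notin> \<mm>" if "a \<notin> \<mm>" "b \<notin> \<mm>" for a b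
    
    using that mult_dvd_mono[of a 1 b 1] unfolding local_ring_unit_iff[OF loc, symmetric] by simp
  have add_notin: "a + b \<notin> \<mm>" if "a \<notin> \<mm>" "b \<in> \<mm>" for a b
    using that m(6)[of "a + b" b] by auto
  have add_notin': "b + a \<notin> \<mm>" if "a \<notin> \<mm>" "b \<in> \<mm>" for a b
    using add_notin[OF that] by (simp add: add.commute)
  have hom: "ring_hom_ring (ring_of_type_algebra :: 'a ring) (residue_ring 2) h"
  proof (rule ring_hom_ringI)
    show "ring (ring_of_type_algebra :: 'a ring)" by (rule ring_from_type_algebra)
    show "ring (residue_ring 2)"
      using residues.cring[of 2] by (simp add: residues_def cring.axioms)
  next
    fix x y :: 'a
    show "h (x \<otimes>\<^bsub>ring_of_type_algebra\<^esub> y) = h x \<otimes>\<^bsub>residue_ring 2\<^esub> h y"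
      using m(3)[of y x] m(4)[of x y] mult_notin[of x y]
      by (simp add: h_def ring_of_type_algebra_def residue_ring_def)
    show "h (x \<oplus>\<^bsub>ring_of_type_algebra\<^esub> y) = h x \<oplus>\<^bsub>residue_ring 2\<^esub> h y"
      using m(2)[of x y] add_in[of x y] add_notin[of x y] add_notin'[of y x]
      by (simp add: h_def ring_of_type_algebra_def residue_ring_def)
  qed (use one in \<open>auto simp: h_def ring_of_type_algebra_def residue_ring_def\<close>)
  have "h ` carrier ring_of_type_algebra = carrier (residue_ring 2)"
  proof -
    have "{0..1::int} = {0, 1}" by auto
    moreover have "h 0 = 0" "h 1 = 1" using m(1) one by (simp_all add: h_def)
    then have "{0, 1} \<subseteq> range h" by (metis empty_subsetI insert_subset rangeI)
    moreover have "range h \<subseteq> {0, 1}" by (auto simp: h_def)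
    ultimately have "range h = {0..1}" by blast
    then show ?thesis
      by (simp add: ring_of_type_algebra_def residue_ring_def)
  qed
  then have "ring_of_type_algebra Quot (a_kernel ring_of_type_algebra (residue_ring 2) h)
      \<simeq> residue_ring 2"
    by (rule ring_hom_ring.FactRing_iso[OF hom])
  moreover have "a_kernel ring_of_type_algebra (residue_ring 2) h = \<mm>"
    by (auto simp: a_kernel_def' h_def ring_of_type_algebra_def residue_ring_def)
  ultimately show False using F by (simp add: residue_field_def)
qed

text \<open>An inverse in a ring without division. At a nonunit the value is arbitrary; the equation
  \<open>a * recip a = 1\<close> is available for units only.\<close>

definition recip :: "'a::comm_ring_1 \<Rightarrow> 'a" where
  "recip a = (SOME y. a * y = 1)"

lemma mult_recip:
  assumes "a dvd 1"
  shows "a * recip a = 1"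
proof -
  from assms obtain k where "1 = a * k" by (rule dvdE)
  then have "a * k = 1" by (rule sym)
  then show ?thesis unfolding recip_def by (rule someI[of "\<lambda>y. a * y = 1"])
qed

lemma mult_dvd_one_iff: "a * b dvd 1 \<longleftrightarrow> a dvd 1 \<and> b dvd (1 :: 'a::comm_ring_1)"
  using mult_dvd_mono[of a 1 b 1] dvd_mult_left[of a b 1] dvd_mult_right[of a b 1]
  unfolding mult_1 by blast

section \<open>Bases over a local ring and their cardinality\<close>

locale local_inner_product_space = inner_product_space scale \<bb>
  for scale :: "'a::comm_ring_1 \<Rightarrow> 'b::ab_group_add \<Rightarrow> 'b" (infixr \<open>*s\<close> 75)
    and \<bb> :: "'b \<Rightarrow> 'b \<Rightarrow> 'a" +
  fixes \<mm> :: "'a set"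
  assumes local_ring: "local_ring \<mm>"
begin

lemmas m_zero = local_ring_zero[OF local_ring]
  and m_add = local_ring_add[OF local_ring]
  and m_mult = local_ring_mult[OF local_ring]
  and m_mult_right = local_ring_mult_right[OF local_ring]
  and m_uminus = local_ring_uminus[OF local_ring]
  and m_diff = local_ring_diff[OF local_ring]
  and m_sum = local_ring_sum[OF local_ring]
  and unit_iff = local_ring_unit_iff[OF local_ring]

lemma not_unit_zero: "\<not> 0 dvd (1::'a)"
  using unit_iff m_zero by blast

lemma one_neq_zero: "(1::'a) \<noteq> 0"
  using not_unit_zero by (metis dvd_refl)

lemma
  shows form_add_left: "\<bb> (x + y) z = \<bb> x z + \<bb> y z"
    and form_add_right: "\<bb> z (x + y) = \<bb> z x + \<bb> z y"
    and form_scale_left: "\<bb> (r *s x) z = r * \<bb> x z"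
    and form_scale_right: "\<bb> z (r *s x) = r * \<bb> z x"
    and form_zero_left: "\<bb> 0 z = 0"
    and form_sum_left: "\<bb> (sum f I) z = (\<Sum>i\<in>I. \<bb> (f i) z)"
  using module_hom.add[OF linear_left] module_hom.add[OF linear_right]
    module_hom.scale[OF linear_left] module_hom.scale[OF linear_right]
    module_hom.zero[OF linear_left] module_hom.sum[OF linear_left]
  by blast+

lemma is_basis_coordinates:
  assumes "is_basis B"
  obtains c where "x = (\<Sum>v\<in>B. c v *s v)"
proof (rule that)
  show "x = (\<Sum>v\<in>B. representation B x v *s v)"
    using assms by (intro sum_representation_eq[symmetric]) (auto simp: is_basis_def)
qed

text \<open>Over a local ring the Steinitz exchange works as soon as the coefficient of the removed
  vector is a unit.\<close>

lemma is_basis_exchange: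
  assumes B: "is_basis B" and v: "v \<in> B"
    and w: "w = (\<Sum>u\<in>B. c u *s u)" and unit: "c v dvd 1"
  shows "is_basis (insert w (B - {v}))" and "w \<notin> B - {v}"
proof -
  have fin: "finite B" and ind: "independent B" and sp: "span B = UNIV"
    using B by (auto simp: is_basis_def)
  have w': "w = c v *s v + (\<Sum>u\<in>B-{v}. c u *s u)"
    unfolding w by (rule sum.remove[OF fin v])
  have rep: "d u = 0" if "(\<Sum>u\<in>B. d u *s u) = 0" "u \<in> B" for d u
    using that by (rule independentD[OF ind fin order_refl])
  \<comment> \<open>Independence of the family made of \<open>w\<close> and \<open>B - {v}\<close>,
    phrased so that it makes sense even before \<open>w\<close> is known to lie outside
    \<open>B - {v}\<close>. Rewritten over \<open>B\<close>, the relation has coefficient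
    \<open>k * c v\<close> at \<open>v\<close>, and the unit \<open>c v\<close> forces
    \<open>k = 0\<close>.\<close>
  have key: "k = 0 \<and> (\<forall>u\<in>B-{v}. d u = 0)"
    if eq: "k *s w + (\<Sum>u\<in>B-{v}. d u *s u) = 0" for k d
  proof -
    define e where "e u = (if u = v then k * c v else k * c u + d u)" for u
    have "(\<Sum>u\<in>B. e u *s u) = e v *s v + (\<Sum>u\<in>B-{v}. e u *s u)"
      by (rule sum.remove[OF fin v])
    also have "(\<Sum>u\<in>B-{v}. e u *s u) = (\<Sum>u\<in>B-{v}. (k * c u) *s u + d u *s u)"
      by (intro sum.cong) (auto simp: e_def scale_left_distrib)
    also have "e v *s v + \<dots> = k *s w + (\<Sum>u\<in>B-{v}. d u *s u)"
      by (simp add: w' e_def sum.distrib scale_right_distrib scale_sum_right)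
    finally have e: "(\<Sum>u\<in>B. e u *s u) = 0" using eq by simp
    have "k * c v = 0" using rep[OF e v] by (simp add: e_def)
    then have "k * (c v * recip (c v)) = 0" by (simp flip: mult.assoc)
    then have "k = 0" by (simp add: mult_recip unit)
    moreover have "d u = 0" if "u \<in> B - {v}" for u
      using rep[OF e, of u] that \<open>k = 0\<close> by (simp add: e_def)
    ultimately show ?thesis by blast
  qed
  show notin: "w \<notin> B - {v}"
  proof
    assume "w \<in> B - {v}"
    \<comment> \<open>The coefficient -1 at \<open>w\<close> yields the trivial relation
      \<open>w - w = 0\<close>, which has \<open>k = 1\<close> and so violates
      \<open>key\<close>.\<close>
    moreover have "(\<Sum>u\<in>B-{v}. (if u = w then -1 else 0) *s u)
        = (\<Sum>u\<in>B-{v}. if u = w then - w else 0)"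
      by (rule sum.cong) auto
    ultimately have "1 *s w + (\<Sum>u\<in>B-{v}. (if u = w then -1 else 0) *s u) = 0"
      using fin by simp
    from key[OF this] show False using one_neq_zero by simp
  qed
  have "independent (insert w (B - {v}))"
  proof
    assume "dependent (insert w (B - {v}))"
    then obtain d where d: "\<exists>u\<in>insert w (B - {v}). d u \<noteq> 0"
      "(\<Sum>u\<in>insert w (B - {v}). d u *s u) = 0"
      using fin by (auto simp: dependent_finite)
    have "d w *s w + (\<Sum>u\<in>B-{v}. d u *s u) = 0"
      using d(2) notin fin by simp
    from key[OF this] have "d w = 0" "\<forall>u\<in>B-{v}. d u = 0" by simp_all
    with d(1) show False by blast
  qed
  moreover have "span (insert w (B - {v})) = UNIV"
  proof -
    let ?S = "span (insert w (B - {v}))"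
    have B': "u \<in> ?S" if "u \<in> B - {v}" for u using that by (intro span_base) auto
    have "w - (\<Sum>u\<in>B-{v}. c u *s u) \<in> ?S"
      using B' by (intro span_diff span_sum span_scale span_base[of w]) auto
    then have "c v *s v \<in> ?S" unfolding w' by simp
    from span_scale[OF this, of "recip (c v)"] have "v \<in> ?S"
      by (simp add: mult.commute[of "recip (c v)"] mult_recip unit)
    with B' have "B \<subseteq> ?S" by blast
    then show ?thesis using span_minimal[of B ?S] sp by auto
  qed
  ultimately show "is_basis (insert w (B - {v}))" using fin by (simp add: is_basis_def)
qed

text \<open>Steinitz exchange, by induction on the number of vectors of \<open>C\<close> missing
  from \<open>B\<close>: a missing \<open>w\<close> replaces some \<open>v \<in> B - C\<close> that
  has a unit coefficient in the expansion of \<open>w\<close>. Once \<open>C \<subseteq> B\<close>,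
  a spanning subset of an independent set is the whole set.\<close>

lemma is_basis_card_eq:
  assumes "is_basis B" "is_basis C"
  shows "card B = card C"
  using assms(1)
proof (induction "card (C - B)" arbitrary: B rule: less_induct)
  case less
  note B = less.prems
  have fin: "finite B" "finite C" using B assms(2) by (auto simp: is_basis_def)
  have indC: "independent C" and spC: "span C = UNIV" using assms(2) by (auto simp: is_basis_def)
  show ?case
  proof (cases "C \<subseteq> B")
    case True
    have "B = C"
      by (rule spanning_subset_independent[OF True]) (simp_all add: spC B[unfolded is_basis_def])
    then show ?thesis by simp
  next
    case False
    then obtain w where w: "w \<in> C" "w \<notin> B" by blast
    from B obtain c where c: "w = (\<Sum>u\<in>B. c u *s u)" by (rule is_basis_coordinates)
    have "\<exists>v\<in>B - C. c v dvd 1"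
    proof (rule ccontr)
      assume "\<not> ?thesis"
      then have cm: "c v \<in> \<mm>" if "v \<in> B - C" for v
        using that unit_iff[of "c v"] by blast
      \<comment> \<open>Read off the \<open>w\<close>-coordinate with respect to \<open>C\<close> on
        both sides of the expansion of \<open>w\<close> in \<open>B\<close>. Vectors of
        \<open>B \<inter> C\<close> contribute 0 because \<open>w \<notin> B\<close>, and the others
        have coefficients in \<open>\<mm>\<close>; so 1 would lie in \<open>\<mm>\<close>.\<close>
      have "representation C (\<Sum>u\<in>B. c u *s u) = (\<lambda>b. \<Sum>u\<in>B. representation C (c u *s u) b)"
        by (rule representation_sum) (simp_all add: indC spC)
      then have "representation C w w = (\<Sum>u\<in>B. representation C (c u *s u) w)"
        unfolding c[symmetric] by (rule fun_cong)
      then have "1 = (\<Sum>u\<in>B. c u * representation C u w)"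
        by (simp add: representation_scale representation_basis indC spC w(1))
      also have "\<dots> \<in> \<mm>"
      proof (rule m_sum)
        fix u assume u: "u \<in> B"
        show "c u * representation C u w \<in> \<mm>"
        proof (cases "u \<in> C")
          case True
          then show ?thesis using w u m_zero by (auto simp: representation_basis indC)
        next
          case False
          with u have "c u \<in> \<mm>" by (intro cm) simp
          then show ?thesis by (rule m_mult_right)
        qed
      qed
      finally show False using unit_iff[of 1] by simp
    qed
    then obtain v where v: "v \<in> B" "v \<notin> C" "c v dvd 1" by blast
    let ?B' = "insert w (B - {v})"
    have B': "is_basis ?B'" by (rule is_basis_exchange[OF B v(1) c v(3)])
    have "C - ?B' \<subset> C - B" using w v by auto
    then have "card (C - ?B') < card (C - B)" using fin by (intro psubset_card_mono) auto
    then have "card ?B' = card C" using B' by (rule less.hyps)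
    moreover have "card ?B' = card B"
      using fin w card.remove[OF fin(1) v(1)] by simp
    ultimately show ?thesis by simp
  qed
qed

lemma rank_eq_card: "is_basis B \<Longrightarrow> rank = card B"
  unfolding rank_def by (rule the_equality) (blast, metis is_basis_card_eq)

section \<open>Orthogonal bases and expansions in them\<close>

lemma orthogonal_basis_norm_unit:
  assumes B: "orthogonal_basis B" and v: "v \<in> B"
  shows "\<bb> v v dvd 1"
proof -
  have fin: "finite B" and ind: "independent B" and sp: "span B = UNIV"
    using B by (auto simp: orthogonal_basis_def is_basis_def)
  \<comment> \<open>Nondegeneracy represents the coordinate functional of \<open>v\<close> as
    \<open>\<bb> u\<close> for some \<open>u\<close>. Evaluating it at \<open>v\<close> and
    expanding \<open>u\<close> in \<open>B\<close> exhibits an inverse of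
    \<open>\<bb> v v\<close>.\<close>
  have "Modules.module_hom scale (*) (\<lambda>x. representation B x v)"
    using ind sp linear_left[of v]
    by (simp add: module_hom_iff representation_add representation_scale)
  then obtain u where u: "(\<lambda>y. \<bb> u y) = (\<lambda>x. representation B x v)"
    using nondegenerate unfolding bij_betw_def by (metis (mono_tags, lifting) imageE mem_Collect_eq)
  have "1 = \<bb> u v"
    using fun_cong[OF u, of v] by (simp add: representation_basis ind v)
  also have "u = (\<Sum>x\<in>B. representation B u x *s x)"
    by (rule sum_representation_eq[symmetric]) (use ind sp fin in auto)
  also have "\<bb> \<dots> v = (\<Sum>x\<in>B. if x = v then representation B u v * \<bb> v v else 0)"
    unfolding form_sum_left using B v
    by (intro sum.cong) (auto simp: form_scale_left orthogonal_basis_def)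
  also have "\<dots> = representation B u v * \<bb> v v" using fin v by simp
  finally have "1 = \<bb> v v * representation B u v" by (simp only: mult.commute)
  then show ?thesis by (rule dvdI)
qed

text \<open>Unit norms make independence automatic: pairing a linear relation with \<open>v\<close>
  leaves only \<open>d v * \<bb> v v = 0\<close>.\<close>

lemma orthogonal_basisI:
  assumes fin: "finite B" and orth: "\<And>v w. v \<in> B \<Longrightarrow> w \<in> B \<Longrightarrow> v \<noteq> w \<Longrightarrow> \<bb> v w = 0"
    and unit: "\<And>v. v \<in> B \<Longrightarrow> \<bb> v v dvd 1" and sp: "span B = UNIV"
  shows "orthogonal_basis B"
proof -
  have "independent B"
  proof
    assume "dependent B"
    then obtain d v where d: "v \<in> B" "d v \<noteq> 0" "(\<Sum>u\<in>B. d u *s u) = 0"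
      using fin by (auto simp: dependent_finite)
    have "0 = \<bb> (\<Sum>u\<in>B. d u *s u) v" by (simp add: d(3) form_zero_left)
    also have "\<dots> = (\<Sum>u\<in>B. if u = v then d v * \<bb> v v else 0)"
      unfolding form_sum_left by (intro sum.cong) (auto simp: form_scale_left orth d(1))
    also have "\<dots> = d v * \<bb> v v" using fin d(1) by simp
    finally have "d v * (\<bb> v v * recip (\<bb> v v)) = 0" by (simp flip: mult.assoc)
    then show False using d(1,2) by (simp add: mult_recip unit)
  qed
  then show ?thesis using assms by (auto simp: orthogonal_basis_def is_basis_def)
qed

lemma orthogonal_expansion:
  assumes B: "orthogonal_basis B"
  shows "x = (\<Sum>v\<in>B. (\<bb> x v * recip (\<bb> v v)) *s v)"
proof -
  have fin: "finite B" and basis: "is_basis B"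
    using B by (auto simp: orthogonal_basis_def is_basis_def)
  from basis obtain c where c: "x = (\<Sum>v\<in>B. c v *s v)" by (rule is_basis_coordinates)
  have "c v = \<bb> x v * recip (\<bb> v v)" if v: "v \<in> B" for v
  proof -
    have "\<bb> x v = (\<Sum>u\<in>B. if u = v then c v * \<bb> v v else 0)"
      unfolding c form_sum_left using B v
      by (intro sum.cong) (auto simp: form_scale_left orthogonal_basis_def)
    also have "\<dots> = c v * \<bb> v v" using fin v by simp
    finally have "\<bb> x v * recip (\<bb> v v) = c v * (\<bb> v v * recip (\<bb> v v))" by (simp add: mult.assoc)
    then show ?thesis by (simp add: mult_recip orthogonal_basis_norm_unit[OF B v])
  qed
  then have "(\<Sum>v\<in>B. c v *s v) = (\<Sum>v\<in>B. (\<bb> x v * recip (\<bb> v v)) *s v)"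
    by (intro sum.cong) auto
  with c show ?thesis by simp
qed

lemma parseval:
  assumes "orthogonal_basis B"
  shows "\<bb> x y = (\<Sum>v\<in>B. \<bb> x v * \<bb> y v * recip (\<bb> v v))"
proof -
  have "\<bb> x y = \<bb> (\<Sum>v\<in>B. (\<bb> x v * recip (\<bb> v v)) *s v) y"
    using orthogonal_expansion[OF assms, of x] by simp
  also have "\<dots> = (\<Sum>v\<in>B. \<bb> x v * recip (\<bb> v v) * \<bb> v y)"
    by (simp add: form_sum_left form_scale_left)
  also have "\<dots> = (\<Sum>v\<in>B. \<bb> x v * \<bb> y v * recip (\<bb> v v))"
    unfolding symmetric[of y] by (simp add: mult_ac)
  finally show ?thesis .
qed

section \<open>Building chains of orthogonal bases\<close>

lemma chain_equivalent_refl: "orthogonal_basis B \<Longrightarrow> chain_equivalent B B"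
  unfolding chain_equivalent_def by (intro exI[of _ 0] exI[of _ "\<lambda>_. B"]) simp

text \<open>Appends one basis to a chain. The overlap is measured against \<open>card B\<close>,
  which equals \<open>rank\<close>, so that later arguments can count in the current basis.\<close>

lemma chain_equivalent_step:
  assumes "chain_equivalent A B" "orthogonal_basis C" "card B \<le> card (B \<inter> C) + 2"
  shows "chain_equivalent A C"
proof -
  from assms(1) obtain r :: nat and Bs where Bs: "\<forall>i\<le>r. orthogonal_basis (Bs i)" "Bs 0 = A"
    "Bs r = B" "\<forall>i\<in>{1..r}. rank \<le> card (Bs (i - 1) \<inter> Bs i) + 2"
    unfolding chain_equivalent_def by (elim exE conjE)
  have "orthogonal_basis B" using Bs(1,3) by blast
  then have rank: "rank = card B" by (simp add: orthogonal_basis_def rank_eq_card)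
  define Cs where "Cs = Bs(Suc r := C)"
  have "rank \<le> card (Cs (i - 1) \<inter> Cs i) + 2" if "i \<in> {1..Suc r}" for i
  proof (cases "i = Suc r")
    case True
    then show ?thesis using assms(3) Bs(3) rank by (simp add: Cs_def)
  next
    case False
    then have "i \<in> {1..r}" "i - 1 \<noteq> Suc r" using that by auto
    then show ?thesis using Bs(4) False by (simp add: Cs_def)
  qed
  moreover have "\<forall>i\<le>Suc r. orthogonal_basis (Cs i)" "Cs 0 = A" "Cs (Suc r) = C"
    using Bs(1,2) assms(2) by (auto simp: Cs_def)
  ultimately show ?thesis unfolding chain_equivalent_def by blast
qed

lemma chain_equivalent_orthogonal: "chain_equivalent A B \<Longrightarrow> orthogonal_basis B"
  unfolding chain_equivalent_def by (elim exE conjE) blast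

section \<open>Rotations in the plane of two basis vectors, and weights\<close>

lemma m_mult_iff: "a * b \<in> \<mm> \<longleftrightarrow> a \<in> \<mm> \<or> b \<in> \<mm>"
  using mult_dvd_one_iff[of a b] unit_iff by blast

lemma m_add_iff: "a \<in> \<mm> \<Longrightarrow> a + b \<in> \<mm> \<longleftrightarrow> b \<in> \<mm>"
  using m_add[of a b] m_diff[of "a + b" a] by auto

lemma mult_recip_m: "a \<notin> \<mm> \<Longrightarrow> a * recip a = 1"
  using mult_recip unit_iff by blast

lemma recip_notin_m: "a \<notin> \<mm> \<Longrightarrow> recip a \<notin> \<mm>"
  using mult_recip_m[of a] m_mult[of "recip a" a] unit_iff[of 1] by auto

text \<open>In the plane of \<open>v1\<close> and \<open>v2\<close> the vector \<open>p'\<close> is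
  orthogonal to \<open>p\<close>, and its norm is \<open>\<bb> v1 v1 * \<bb> v2 v2\<close> times
  that of \<open>p\<close>. The change of coordinates has the norm of \<open>p\<close> as its
  determinant. One unit condition therefore gives both unit norms and the spanning property.\<close>

lemma orthogonal_basis_rotate:
  assumes B: "orthogonal_basis B" and v: "v1 \<in> B" "v2 \<in> B" "v1 \<noteq> v2"
    and unit: "\<alpha> * \<alpha> * \<bb> v1 v1 + \<beta> * \<beta> * \<bb> v2 v2 \<notin> \<mm>"
  defines "p \<equiv> \<alpha> *s v1 + \<beta> *s v2"
    and "p' \<equiv> (- (\<beta> * \<bb> v2 v2)) *s v1 + (\<alpha> * \<bb> v1 v1) *s v2"
  shows "orthogonal_basis (insert p (insert p' (B - {v1, v2})))"
    and "\<bb> p p = \<alpha> * \<alpha> * \<bb> v1 v1 + \<beta> * \<beta> * \<bb> v2 v2"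
    and "p \<notin> B - {v1, v2}"
    and "card B \<le> card (B \<inter> insert p (insert p' (B - {v1, v2}))) + 2"
proof -
  let ?a = "\<bb> v1 v1" and ?b = "\<bb> v2 v2" and ?B = "insert p (insert p' (B - {v1, v2}))"
  define N where "N = \<alpha> * \<alpha> * ?a + \<beta> * \<beta> * ?b"
  have fin: "finite B" and sp: "span B = UNIV"
    and orth: "\<And>u v. u \<in> B \<Longrightarrow> v \<in> B \<Longrightarrow> u \<noteq> v \<Longrightarrow> \<bb> u v = 0"
    using B by (auto simp: orthogonal_basis_def is_basis_def)
  have norm: "\<bb> u u \<notin> \<mm>" if "u \<in> B" for u
    using orthogonal_basis_norm_unit[OF B that] unit_iff by blast
  have N: "N \<notin> \<mm>" using unit by (simp add: N_def)
  have v12: "\<bb> v1 v2 = 0" "\<bb> v2 v1 = 0" using orth v by auto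
  note form = form_add_left form_add_right form_scale_left form_scale_right v12
  show pp: "\<bb> p p = N"
    by (simp add: p_def form N_def algebra_simps)
  have p'p': "\<bb> p' p' = ?a * ?b * N"
    unfolding p'_def form by (simp add: N_def algebra_simps)
  have pp': "\<bb> p p' = 0" "\<bb> p' p = 0"
    unfolding p_def p'_def form by (simp_all add: algebra_simps)
  have pu: "\<bb> p u = 0" "\<bb> u p = 0" "\<bb> p' u = 0" "\<bb> u p' = 0" if "u \<in> B - {v1, v2}" for u
  proof -
    have "\<bb> v1 u = 0" "\<bb> v2 u = 0" "\<bb> u v1 = 0" "\<bb> u v2 = 0" using that v orth by auto
    then show "\<bb> p u = 0" "\<bb> u p = 0" "\<bb> p' u = 0" "\<bb> u p' = 0"
      unfolding p_def p'_def form by simp_all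
  qed
  show "p \<notin> B - {v1, v2}"
  proof
    assume "p \<in> B - {v1, v2}"
    from pu(1)[OF this] have "N = 0" by (simp only: pp)
    then show False using N m_zero by simp
  qed
  show "orthogonal_basis ?B"
  proof (rule orthogonal_basisI)
    show "finite ?B" using fin by simp
    show "\<bb> u w = 0" if "u \<in> ?B" "w \<in> ?B" "u \<noteq> w" for u w
      using that pp' pu orth by auto
    show "\<bb> u u dvd 1" if "u \<in> ?B" for u
      using that N norm v by (auto simp: unit_iff pp p'p' m_mult_iff)
    let ?S = "span ?B"
    have in_S: "u \<in> ?S" if "u \<in> ?B" for u using that by (rule span_base)
    \<comment> \<open>Cramer's rule for the transition matrix, whose determinant is
      \<open>N\<close>.\<close>
    have v1: "N *s v1 = (\<alpha> * ?a) *s p - \<beta> *s p'"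
      by (simp add: p_def p'_def N_def algebra_simps)
    have v2: "N *s v2 = (\<beta> * ?b) *s p + \<alpha> *s p'"
      by (simp add: p_def p'_def N_def algebra_simps)
    have "N *s v1 \<in> ?S" "N *s v2 \<in> ?S"
      unfolding v1 v2 by (intro span_diff span_add span_scale in_S; simp)+
    then have "recip N *s N *s v1 \<in> ?S" "recip N *s N *s v2 \<in> ?S"
      by (auto intro: span_scale simp del: scale_scale)
    then have "v1 \<in> ?S" "v2 \<in> ?S"
      by (simp_all add: mult.commute[of "recip N"] mult_recip_m N)
    then have "B \<subseteq> ?S" using in_S by blast
    then show "?S = UNIV" using span_minimal[of B ?S] sp by auto
  qed
  have "card B = card (B - {v1, v2}) + 2"
    using fin v card_Diff_subset[of "{v1, v2}" B] card_mono[of B "{v1, v2}"] by simp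
  also have "card (B - {v1, v2}) \<le> card (B \<inter> ?B)"
    using fin by (intro card_mono) auto
  finally show "card B \<le> card (B \<inter> ?B) + 2" by simp
qed

text \<open>When \<open>\<bb> v v\<close> is a unit, this is the norm of the orthogonal projection
  of \<open>w\<close> to the line of \<open>v\<close>.\<close>

definition weight :: "'b \<Rightarrow> 'b \<Rightarrow> 'a" where
  "weight w v = \<bb> w v * \<bb> w v * recip (\<bb> v v)"

lemma norm_eq_sum_weight: "orthogonal_basis B \<Longrightarrow> \<bb> w w = (\<Sum>v\<in>B. weight w v)"
  unfolding weight_def by (rule parseval)

text \<open>Here \<open>p\<close> is the orthogonal projection of \<open>w\<close> to the plane of
  \<open>v1\<close> and \<open>v2\<close>. Hence \<open>\<bb> w p\<close> and
  \<open>\<bb> p p\<close> both equal the sum \<open>N\<close> of the two weights, \<open>p\<close>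
  has weight \<open>N * N / N\<close>, and the vector \<open>p'\<close> of the plane, being
  orthogonal to \<open>p\<close>, is orthogonal to \<open>w\<close>.\<close>

lemma combine_in_chain:
  assumes AB: "chain_equivalent A B" and v: "v1 \<in> B" "v2 \<in> B" "v1 \<noteq> v2"
    and unit: "weight w v1 + weight w v2 \<notin> \<mm>"
  obtains p p' where "chain_equivalent A (insert p (insert p' (B - {v1, v2})))"
    "weight w p = weight w v1 + weight w v2" "\<bb> w p' = 0" "p \<notin> B - {v1, v2}"
proof -
  have B: "orthogonal_basis B" using AB by (rule chain_equivalent_orthogonal)
  define \<alpha> \<beta> where "\<alpha> = \<bb> w v1 * recip (\<bb> v1 v1)" and "\<beta> = \<bb> w v2 * recip (\<bb> v2 v2)"
  define p p' where "p = \<alpha> *s v1 + \<beta> *s v2"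
    and "p' = (- (\<beta> * \<bb> v2 v2)) *s v1 + (\<alpha> * \<bb> v1 v1) *s v2"
  have r: "\<bb> v1 v1 * recip (\<bb> v1 v1) = 1" "\<bb> v2 v2 * recip (\<bb> v2 v2) = 1"
    using mult_recip orthogonal_basis_norm_unit[OF B] v by auto
  have \<alpha>: "\<alpha> * \<bb> v1 v1 = \<bb> w v1" and \<beta>: "\<beta> * \<bb> v2 v2 = \<bb> w v2"
    using r by (simp_all add: \<alpha>_def \<beta>_def mult.assoc mult.commute[of "recip _"])
  define N where "N = weight w v1 + weight w v2"
  have N: "\<alpha> * \<alpha> * \<bb> v1 v1 + \<beta> * \<beta> * \<bb> v2 v2 = N"
    unfolding mult.assoc \<alpha> \<beta> by (simp add: N_def weight_def \<alpha>_def \<beta>_def mult_ac)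
  have unit': "\<alpha> * \<alpha> * \<bb> v1 v1 + \<beta> * \<beta> * \<bb> v2 v2 \<notin> \<mm>"
    unfolding N using unit by (simp add: N_def)
  note rot = orthogonal_basis_rotate[OF B v unit', folded p_def p'_def]
  have "\<bb> w p = N"
    by (simp add: p_def form_add_right form_scale_right N_def weight_def \<alpha>_def \<beta>_def mult_ac)
  moreover have "\<bb> p p = N" using rot(2) N by simp
  ultimately have "weight w p = N"
    using unit mult_recip_m[of N] by (simp add: weight_def N_def mult.assoc)
  moreover have "\<bb> w p' = 0"
    unfolding p'_def \<alpha> \<beta> form_add_right form_scale_right by (simp add: mult.commute)
  moreover have "chain_equivalent A (insert p (insert p' (B - {v1, v2})))"
    by (rule chain_equivalent_step[OF AB rot(1) rot(4)])
  ultimately show ?thesis using that rot(3) by (simp add: N_def)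
qed

section \<open>Absorbing one vector of the target basis\<close>

lemma sum_square_cong:
  assumes "2 \<in> \<mm>"
  shows "(\<Sum>i\<in>I. f i) * (\<Sum>i\<in>I. f i) - (\<Sum>i\<in>I. f i * f i) \<in> \<mm>"
proof (induction I rule: infinite_finite_induct)
  case (insert i I)
  \<comment> \<open>The cross term that appears when \<open>f i\<close> joins the sum; squaring is
    additive modulo \<open>\<mm>\<close> because 2 vanishes there.\<close>
  have "2 * (f i * sum f I) \<in> \<mm>" using assms by (rule m_mult_right)
  with insert.IH have "(sum f I * sum f I - (\<Sum>i\<in>I. f i * f i)) + 2 * (f i * sum f I) \<in> \<mm>"
    by (rule m_add)
  with insert.hyps show ?case by (simp add: algebra_simps)
qed (simp_all add: m_zero)

text \<open>\<open>D\<close> is the part of \<open>C\<close> already reached. The induction is on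
  the number of vectors of the current basis that are not orthogonal to \<open>w\<close>; vectors of
  \<open>D\<close> are orthogonal to \<open>w\<close>, and every vector that gets replaced lies
  outside \<open>D\<close>.\<close>

lemma chain_equivalent_absorb:
  assumes C: "orthogonal_basis C" "w \<in> C" "D \<subseteq> C" "w \<notin> D"
    and s: "s \<notin> \<mm>" "s - 1 \<notin> \<mm>"
    and AB: "chain_equivalent A B" "D \<subseteq> B"
  shows "\<exists>B'. chain_equivalent A B' \<and> insert w D \<subseteq> B'"
  using AB
proof (induction "card {v \<in> B. \<bb> w v \<noteq> 0}" arbitrary: B rule: less_induct)
  case less
  note AB = less.prems
  define S where "S = {v \<in> B. \<bb> w v \<noteq> 0}"
  have B: "orthogonal_basis B" using AB(1) by (rule chain_equivalent_orthogonal)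
  have basis: "is_basis B" using B by (simp add: orthogonal_basis_def)
  have fin: "finite B" using basis by (simp add: is_basis_def)
  have finS: "finite S" and SB: "S \<subseteq> B" using fin by (auto simp: S_def)
  \<comment> \<open>The induction hypothesis with a mere upper bound \<open>T\<close> for the new
    support, so that the support after rotations need not be determined exactly.\<close>
  have IH: ?case if "chain_equivalent A B'" "D \<subseteq> B'" "{v \<in> B'. \<bb> w v \<noteq> 0} \<subseteq> T"
    "finite T" "card T < card S" for B' T
  proof (rule less.hyps)
    have "card {v \<in> B'. \<bb> w v \<noteq> 0} \<le> card T" using that(3,4) by (intro card_mono)
    then show "card {v \<in> B'. \<bb> w v \<noteq> 0} < card {v \<in> B. \<bb> w v \<noteq> 0}"
      using that(5) by (simp add: S_def)
  qed (use that in auto)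
  have DS: "v \<notin> D" if "v \<in> S" for v
  proof
    assume "v \<in> D"
    then have "v \<in> C" "w \<noteq> v" using C(3,4) by auto
    then have "\<bb> w v = 0" using C(1,2) by (simp add: orthogonal_basis_def)
    with that show False by (simp add: S_def)
  qed
  have sum_S: "(\<Sum>v\<in>B. \<bb> w v * g v) = (\<Sum>v\<in>S. \<bb> w v * g v)" for g
    using fin by (intro sum.mono_neutral_right) (auto simp: S_def)
  have norm_w: "\<bb> w w \<notin> \<mm>"
    using orthogonal_basis_norm_unit[OF C(1,2)] unit_iff by simp
  have sum_weight: "\<bb> w w = (\<Sum>v\<in>S. weight w v)"
    using norm_eq_sum_weight[OF B, of w] sum_S[of "\<lambda>v. \<bb> w v * recip (\<bb> v v)"]
    by (simp add: weight_def mult.assoc)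
  have "\<exists>v\<in>S. weight w v \<notin> \<mm>"
  proof (rule ccontr)
    assume "\<not> ?thesis"
    then have "(\<Sum>v\<in>S. weight w v) \<in> \<mm>" by (intro m_sum) simp
    with norm_w sum_weight show False by simp
  qed
  then obtain v0 where v0: "v0 \<in> S" "weight w v0 \<notin> \<mm>" by blast
  show ?case
  proof (cases "\<exists>v1\<in>S. \<exists>v2\<in>S. v1 \<noteq> v2 \<and> weight w v1 + weight w v2 \<notin> \<mm>")
    case True
    then obtain v1 v2 where v: "v1 \<in> S" "v2 \<in> S" "v1 \<noteq> v2"
      and unit: "weight w v1 + weight w v2 \<notin> \<mm>" by blast
    have vB: "v1 \<in> B" "v2 \<in> B" using v SB by auto
    obtain p p' where p: "chain_equivalent A (insert p (insert p' (B - {v1, v2})))"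
      and p': "\<bb> w p' = 0"
      using combine_in_chain[OF AB(1) vB v(3) unit] by blast
    show ?thesis
    proof (rule IH[OF p])
      show "D \<subseteq> insert p (insert p' (B - {v1, v2}))" using AB(2) DS v by auto
      \<comment> \<open>\<open>v1\<close> and \<open>v2\<close> leave the support, and at most
        \<open>p\<close> enters it.\<close>
      show "{v \<in> insert p (insert p' (B - {v1, v2})). \<bb> w v \<noteq> 0} \<subseteq> insert p (S - {v1, v2})"
        using p' by (auto simp: S_def)
      show "finite (insert p (S - {v1, v2}))" using finS by simp
      have "card {v1, v2} \<le> card S" using finS v by (intro card_mono) auto
      moreover have "card (S - {v1, v2}) = card S - card {v1, v2}"
        using v by (intro card_Diff_subset) auto
      moreover have "card (insert p (S - {v1, v2})) \<le> Suc (card (S - {v1, v2}))"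
        by (rule card_insert_le_m1) simp_all
      ultimately show "card (insert p (S - {v1, v2})) < card S" using v(3) by simp
    qed
  next
    case False
    then have pair: "weight w u + weight w v \<in> \<mm>" if "u \<in> S" "v \<in> S" "u \<noteq> v" for u v
      using that by blast
    show ?thesis
    proof (cases "S = {v0}")
      case True
      \<comment> \<open>All vectors of \<open>B\<close> other than \<open>v0\<close> are orthogonal
        to \<open>w\<close>, so \<open>w\<close> is a unit multiple of \<open>v0\<close> and can
        take its place without disturbing orthogonality.\<close>
      define c where "c v = \<bb> w v * recip (\<bb> v v)" for v
      have v0B: "v0 \<in> B" using v0 SB by auto
      have w: "w = (\<Sum>v\<in>B. c v *s v)" unfolding c_def by (rule orthogonal_expansion[OF B])
      have "c v0 \<notin> \<mm>" using v0(2) by (simp add: c_def weight_def mult.assoc m_mult_iff)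
      then have c: "c v0 dvd 1" by (simp add: unit_iff)
      let ?B' = "insert w (B - {v0})"
      have "orthogonal_basis ?B'"
        unfolding orthogonal_basis_def
      proof (intro conjI ballI impI)
        show "is_basis ?B'" by (rule is_basis_exchange[OF basis v0B w c])
        have orth: "\<bb> w v = 0" "\<bb> v w = 0" if "v \<in> B - {v0}" for v
          using that True symmetric[of v w] by (auto simp: S_def)
        fix u v assume "u \<in> ?B'" "v \<in> ?B'" "u \<noteq> v"
        then show "\<bb> u v = 0" using B orth by (auto simp: orthogonal_basis_def)
      qed
      moreover have "card B \<le> card (B \<inter> ?B') + 2"
      proof -
        have "card (B - {v0}) \<le> card (B \<inter> ?B')" using fin by (intro card_mono) auto
        then show ?thesis using fin v0B by (simp add: card_Diff_singleton)
      qed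
      ultimately have "chain_equivalent A ?B'" by (rule chain_equivalent_step[OF AB(1)])
      moreover have "insert w D \<subseteq> ?B'" using AB(2) DS v0(1) by auto
      ultimately show ?thesis by blast
    next
      case False
      then obtain v1 where v1: "v1 \<in> S" "v1 \<noteq> v0" using v0(1) by blast
      have unit_S: "weight w v \<notin> \<mm>" if "v \<in> S" for v
      proof (cases "v = v0")
        case False
        then show ?thesis using pair[OF that v0(1)] v0(2) m_add_iff by blast
      qed (use v0 in simp)
      have "S \<noteq> {v0, v1}"
      proof
        assume "S = {v0, v1}"
        then have "\<bb> w w = weight w v0 + weight w v1" using sum_weight v1 by simp
        then show False using norm_w pair[OF v0(1) v1(1)] v1(2) by simp
      qed
      then obtain v2 where v2: "v2 \<in> S" "v2 \<noteq> v0" "v2 \<noteq> v1" using v0(1) v1(1) by blast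
      \<comment> \<open>With three vectors in the support, their pairwise sums combine to twice a
        unit weight, which puts 2 into \<open>\<mm>\<close>.\<close>
      have "(weight w v0 + weight w v1) + (weight w v0 + weight w v2) - (weight w v1 + weight w v2) \<in> \<mm>"
        using v0(1) v1 v2 by (intro m_add m_diff pair) auto
      then have "2 * weight w v0 \<in> \<mm>" by (simp add: algebra_simps)
      then have two: "2 \<in> \<mm>" using v0(2) by (simp add: m_mult_iff)
      have cong: "weight w u - weight w v \<in> \<mm>" if "u \<in> S" "v \<in> S" for u v
      proof (cases "u = v")
        case False
        have "(weight w u + weight w v) - 2 * weight w v \<in> \<mm>"
          using pair[OF that False] m_mult_right[OF two] by (rule m_diff)
        then show ?thesis by (simp add: algebra_simps)
      qed (simp add: m_zero)
      have normB: "\<bb> v v \<notin> \<mm>" if "v \<in> B" for v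
        using orthogonal_basis_norm_unit[OF B that] by (simp add: unit_iff)
      have vB: "v0 \<in> B" "v1 \<in> B" "v2 \<in> B" using v0 v1 v2 SB by auto
      show ?thesis
      proof (cases "\<exists>z. z \<in> B \<and> z \<notin> D \<and> z \<notin> S")
        case True
        then obtain z where z: "z \<in> B" "z \<notin> D" "z \<notin> S" by blast
        have wz: "\<bb> w z = 0" using z by (simp add: S_def)
        define a y where "a = \<bb> v2 v2" and "y = \<bb> z z"
        have a: "a \<notin> \<mm>" and y: "y \<notin> \<mm>" using normB vB z by (simp_all add: a_def y_def)
        \<comment> \<open>A unit \<open>t\<close> is wanted for which \<open>v2 + t z\<close> has
          unit norm. If \<open>t = 1\<close> fails, then \<open>t = s\<close> works:
          \<open>a + s * s * y\<close> differs from \<open>a + y\<close> by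
          \<open>(s - 1) * (s + 1) * y\<close>, and \<open>s + 1\<close> is congruent to the unit
          \<open>s - 1\<close>.\<close>
        have "\<exists>t. t \<notin> \<mm> \<and> a + t * t * y \<notin> \<mm>"
        proof (cases "a + y \<in> \<mm>")
          case False
          then show ?thesis using unit_iff[of 1] by (intro exI[of _ 1]) simp
        next
          case True
          have "s + 1 \<notin> \<mm>"
            using s(2) m_diff[OF _ two, of "s + 1"] by (auto simp: algebra_simps)
          then have "(s - 1) * (s + 1) * y \<notin> \<mm>" using s y by (simp add: m_mult_iff)
          then have "(a + y) + (s - 1) * (s + 1) * y \<notin> \<mm>" by (simp add: m_add_iff True)
          then have "a + s * s * y \<notin> \<mm>" by (simp add: algebra_simps)
          then show ?thesis using s(1) by blast
        qed
        then obtain t where t: "t \<notin> \<mm>" "a + t * t * y \<notin> \<mm>" by blast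
        define N where "N = a + t * t * y"
        define q q' where "q = 1 *s v2 + t *s z"
          and "q' = (- (t * \<bb> z z)) *s v2 + (1 * \<bb> v2 v2) *s z"
        define B1 where "B1 = insert q (insert q' (B - {v2, z}))"
        have v2z: "v2 \<noteq> z" using v2 z by blast
        have unit1: "1 * 1 * \<bb> v2 v2 + t * t * \<bb> z z \<notin> \<mm>" using t(2) by (simp add: a_def y_def)
        note rot = orthogonal_basis_rotate[OF B vB(3) z(1) v2z unit1,
            folded q_def q'_def, folded B1_def]
        have AB1: "chain_equivalent A B1" by (rule chain_equivalent_step[OF AB(1) rot(1,4)])
        have qq: "\<bb> q q = N" using rot(2) by (simp add: N_def a_def y_def)
        have wq: "\<bb> w q = \<bb> w v2" by (simp add: q_def form_add_right form_scale_right wz)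
        have N: "N \<notin> \<mm>" using t(2) by (simp add: N_def)
        have wv2: "\<bb> w v2 \<notin> \<mm>" using unit_S[OF v2(1)] by (simp add: weight_def m_mult_iff)
        have unit_q: "weight w q \<notin> \<mm>"
          using wv2 N by (simp add: weight_def qq wq m_mult_iff recip_notin_m)
        \<comment> \<open>Both weights have numerator \<open>\<bb> w v2\<close> squared, over
          \<open>a\<close> and \<open>N\<close>. Clearing denominators leaves \<open>a + N\<close>,
          that is \<open>2 * a + t * t * y\<close>, which is congruent to the unit
          \<open>t * t * y\<close>.\<close>
        have "weight w v2 + weight w q \<notin> \<mm>"
        proof
          assume "weight w v2 + weight w q \<in> \<mm>"
          then have "(weight w v2 + weight w q) * (a * N) \<in> \<mm>" by (rule m_mult_right)
          moreover have "(weight w v2 + weight w q) * (a * N)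
              = \<bb> w v2 * \<bb> w v2 * ((a * recip a) * N + (N * recip N) * a)"
            by (simp add: weight_def qq wq a_def algebra_simps)
          moreover have "\<dots> = \<bb> w v2 * \<bb> w v2 * (2 * a + t * t * y)"
            using a N by (simp add: mult_recip_m) (simp add: N_def algebra_simps)
          ultimately have "2 * a + t * t * y \<in> \<mm>" using wv2 by (simp add: m_mult_iff)
          then have "t * t * y \<in> \<mm>" by (simp add: m_add_iff m_mult_right two)
          then show False using t(1) y by (simp add: m_mult_iff)
        qed
        then have "(weight w v1 - weight w v2) + (weight w v2 + weight w q) \<notin> \<mm>"
          by (subst m_add_iff[OF cong[OF v1(1) v2(1)]])
        then have unit2: "weight w v1 + weight w q \<notin> \<mm>" by simp
        \<comment> \<open>As \<open>q\<close> is new, \<open>v0\<close> and \<open>v1\<close> are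
          distinct from it in \<open>B1\<close>. Now \<open>v1\<close> can be combined with
          \<open>q\<close> to give \<open>p\<close>, and then \<open>v0\<close> with
          \<open>p\<close>: modulo \<open>\<mm>\<close> the weights of \<open>v0\<close> and
          \<open>v1\<close> cancel, leaving the unit weight of \<open>q\<close>.\<close>
        have qB: "q \<notin> B - {v2, z}" by (rule rot(3))
        have v01B1: "v0 \<in> B - {v2, z}" "v1 \<in> B - {v2, z}" using vB v0 v1 v2 z by auto
        then have q01: "v0 \<noteq> q" "v1 \<noteq> q" using qB by auto
        have "v1 \<in> B1" "q \<in> B1" using v01B1 by (auto simp: B1_def)
        from combine_in_chain[OF AB1 this q01(2) unit2]
        obtain p p' where AB2: "chain_equivalent A (insert p (insert p' (B1 - {v1, q})))"
          and p: "weight w p = weight w v1 + weight w q" and p': "\<bb> w p' = 0"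
          and pB1: "p \<notin> B1 - {v1, q}" .
        define B2 where "B2 = insert p (insert p' (B1 - {v1, q}))"
        have v0B1: "v0 \<in> B1 - {v1, q}" using v01B1 v1(2) q01 by (auto simp: B1_def)
        then have v0p: "v0 \<noteq> p" using pB1 by auto
        have v0pB2: "v0 \<in> B2" "p \<in> B2" using v0B1 by (auto simp: B2_def)
        have "(weight w v0 + weight w v1) + weight w q \<notin> \<mm>"
          using unit_q by (subst m_add_iff[OF pair[OF v0(1) v1(1) v1(2)[symmetric]]])
        then have unit3: "weight w v0 + weight w p \<notin> \<mm>" by (simp add: p add.assoc)
        obtain r r' where AB3: "chain_equivalent A (insert r (insert r' (B2 - {v0, p})))"
          and r': "\<bb> w r' = 0"
          using combine_in_chain[OF AB2[folded B2_def] v0pB2 v0p unit3] by blast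
        show ?thesis
        proof (rule IH[OF AB3])
          let ?B3 = "insert r (insert r' (B2 - {v0, p}))" and ?S = "S - {v0, v1, v2}"
          have "D \<subseteq> B - {v2, z} - {v0, v1}" using AB(2) DS v0(1) v1(1) v2(1) z(2) by auto
          moreover have "B - {v2, z} - {v0, v1} \<subseteq> B2 - {v0, p}"
            using qB pB1 by (auto simp: B2_def B1_def)
          ultimately show "D \<subseteq> ?B3" by auto
          \<comment> \<open>Three vectors \<open>v0\<close>, \<open>v1\<close>, \<open>v2\<close>
            leave the support. Only \<open>r\<close> and \<open>q'\<close> may enter:
            \<open>q\<close> and \<open>p\<close> have been used up, while \<open>p'\<close> and
            \<open>r'\<close> are orthogonal to \<open>w\<close>.\<close>
          show "{v \<in> ?B3. \<bb> w v \<noteq> 0} \<subseteq> insert r (insert q' ?S)"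
            using r' p' by (auto simp: B2_def B1_def S_def)
          show "finite (insert r (insert q' ?S))" using finS by simp
          have "card {v0, v1, v2} \<le> card S" using finS v0 v1 v2 by (intro card_mono) auto
          moreover have "card ?S = card S - card {v0, v1, v2}"
            using v0 v1 v2 by (intro card_Diff_subset) auto
          moreover have "card (insert r (insert q' ?S)) \<le> Suc (Suc (card ?S))"
            using finS by (simp add: card_insert_if)
          moreover have "card {v0, v1, v2} = 3" using v1 v2 by auto
          ultimately show "card (insert r (insert q' ?S)) < card S" by linarith
        qed
      next
        case False
        then have BDS: "B \<subseteq> D \<union> S" by blast
        have basisC: "is_basis C" using C(1) by (simp add: orthogonal_basis_def)
        have finD: "finite D" using AB(2) fin by (rule finite_subset)
        \<comment> \<open>\<open>B\<close> contains \<open>D\<close> and the two further vectors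
          \<open>v0\<close> and \<open>v1\<close>, so \<open>C\<close>, having as many vectors,
          cannot be exhausted by \<open>D\<close> and \<open>w\<close>.\<close>
        have "\<not> C \<subseteq> insert w D"
        proof
          assume "C \<subseteq> insert w D"
          then have "card C \<le> card (insert w D)" using finD by (intro card_mono) auto
          also have "\<dots> = Suc (card D)" using finD C(4) by simp
          also have "\<dots> < card (insert v0 (insert v1 D))"
            using finD DS[OF v0(1)] DS[OF v1(1)] v1(2) by simp
          also have "\<dots> \<le> card B" using fin AB(2) vB by (intro card_mono) auto
          also have "card B = card C" using basis basisC by (rule is_basis_card_eq)
          finally show False by simp
        qed
        then obtain u where u: "u \<in> C" "u \<noteq> w" "u \<notin> D" by blast
        have ud: "\<bb> u d = 0" if "d \<in> insert w D" for d
        proof -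
          have "d \<in> C" "u \<noteq> d" using that u C(2,3) by auto
          then show ?thesis using C(1) u(1) by (simp add: orthogonal_basis_def)
        qed
        \<comment> \<open>The terms of the Parseval sum for \<open>\<bb> u w = 0\<close>. The square
          of \<open>e v\<close> is \<open>weight u v * weight w v\<close>; as all weights of
          \<open>w\<close> on \<open>S\<close> are congruent, the sum of these squares is congruent
          to \<open>\<bb> u u * weight w v0\<close>.\<close>
        define e where "e v = \<bb> u v * \<bb> w v * recip (\<bb> v v)" for v
        have "(\<Sum>v\<in>S. e v) = (\<Sum>v\<in>B. e v)"
          using fin by (intro sum.mono_neutral_left) (auto simp: S_def e_def)
        also have "\<dots> = \<bb> u w" unfolding e_def by (rule parseval[OF B, symmetric])
        finally have e: "(\<Sum>v\<in>S. e v) = 0" using ud by simp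
        have e_square: "(\<Sum>v\<in>S. e v * e v) \<in> \<mm>"
          using m_uminus[OF sum_square_cong[OF two, of e S]] by (simp add: e)
        \<comment> \<open>Vectors of \<open>B\<close> outside \<open>S\<close> lie in
          \<open>D\<close>, where \<open>u\<close> is orthogonal to everything.\<close>
        have sum_u: "\<bb> u u = (\<Sum>v\<in>S. weight u v)"
          unfolding norm_eq_sum_weight[OF B, of u] using fin BDS ud
          by (intro sum.mono_neutral_right) (auto simp: S_def weight_def)
        have "(\<Sum>v\<in>S. weight u v * (weight w v0 - weight w v)) \<in> \<mm>"
          by (intro m_sum m_mult cong v0)
        with e_square
        have "(\<Sum>v\<in>S. e v * e v) + (\<Sum>v\<in>S. weight u v * (weight w v0 - weight w v)) \<in> \<mm>"
          by (rule m_add)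
        moreover have "(\<Sum>v\<in>S. e v * e v) + (\<Sum>v\<in>S. weight u v * (weight w v0 - weight w v))
            = (\<Sum>v\<in>S. weight u v * weight w v0)"
          unfolding sum.distrib[symmetric]
          by (rule sum.cong) (simp_all add: e_def weight_def algebra_simps)
        moreover have "\<dots> = \<bb> u u * weight w v0" by (simp add: sum_u sum_distrib_right)
        ultimately have "\<bb> u u \<in> \<mm>" using v0(2) by (simp add: m_mult_iff)
        then show ?thesis
          using orthogonal_basis_norm_unit[OF C(1) u(1)] by (simp add: unit_iff)
      qed
    qed
  qed
qed

section \<open>Assembling the chain\<close>

lemma orthogonal_bases_chain_equivalent:
  assumes s: "s \<notin> \<mm>" "s - 1 \<notin> \<mm>"
    and B: "orthogonal_basis B" and C: "orthogonal_basis C"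
  shows "chain_equivalent B C"
proof -
  have finC: "finite C" and spC: "span C = UNIV"
    using C by (simp_all add: orthogonal_basis_def is_basis_def)
  \<comment> \<open>The vectors of \<open>C\<close> are absorbed one at a time. A basis that
    contains all of \<open>C\<close> equals \<open>C\<close>, because \<open>C\<close> already
    spans.\<close>
  have "\<exists>B'. chain_equivalent B B' \<and> D \<subseteq> B'" if "D \<subseteq> C" for D
    using finite_subset[OF that finC] that
  proof (induction D rule: finite_induct)
    case empty
    then show ?case using chain_equivalent_refl[OF B] by blast
  next
    case (insert w D)
    then obtain B' where "chain_equivalent B B'" "D \<subseteq> B'" by blast
    with insert.prems insert.hyps(2) show ?case
      by (intro chain_equivalent_absorb[OF C _ _ _ s]) auto
  qed
  from this[of C] obtain B' where B': "chain_equivalent B B'" "C \<subseteq> B'" by blast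
  have "is_basis B'"
    using chain_equivalent_orthogonal[OF B'(1)] by (simp add: orthogonal_basis_def)
  then have "independent B'" by (simp add: is_basis_def)
  then have "B' = C"
    using spanning_subset_independent[OF B'(2)] spC by simp
  with B'(1) show ?thesis by simp
qed

end

theorem theorem1p2:
  fixes \<mm> :: "'a::comm_ring_1 set"
    and scale :: "'a \<Rightarrow> 'b::ab_group_add \<Rightarrow> 'b"
    and \<bb> :: "'b \<Rightarrow> 'b \<Rightarrow> 'a"
  assumes "local_ring \<mm>"
    and "\<not> (residue_field \<mm> \<simeq> residue_ring 2)"
    and "inner_product_space scale \<bb>"
    and "inner_product_space.orthogonal_basis scale \<bb> B"
    and "inner_product_space.orthogonal_basis scale \<bb> C"
  shows "inner_product_space.chain_equivalent scale \<bb> B C"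
proof -
  interpret local_inner_product_space scale \<bb> \<mm>
    using assms(1,3)
    by (simp add: local_inner_product_space_def local_inner_product_space_axioms_def)
  obtain s where "s \<notin> \<mm>" "s - 1 \<notin> \<mm>"
    using assms(1,2) by (rule local_ring_not_F2)
  then show ?thesis using assms(4,5) by (rule orthogonal_bases_chain_equivalent)
qed

end
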